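(* For every $q\in K(\!(\mathbf{t})\!)^\circ$ there exist an integer $n\ge1$ and elements $\alpha_1,\dots,\alpha_n\in K$ such that $\operatorname{trop}\big(\prod_{k=1}^n(q-\alpha_k)\big)\ll 1$.
   Context: $K$ is a field of characteristic zero, $\mathbf{t}=(t_1,\dots,t_m)$, $K(\!(\mathbf{t})\!)=\operatorname{Frac}K[\![\mathbf{t}]\!]$. $V\mathbb{B}[\mathbf{t}]$ is the semiring of subsets of $\mathbb{N}^m$ equal to the vertex set of their Newton polyhedron $\operatorname{conv}(\cdot)+\mathbb{R}^m_{\ge0}$, with $a\oplus b$ = vertices of the Newton polyhedron of $a\cup b$, $a\odot b$ = vertices of that of $a+b$; order $a\le b$ iff $a\oplus b=b$. $V\mathbb{B}(\mathbf{t})$ is its fraction semifield, ordered by $a/b\le c/d$ iff $a\odot d\le b\odot c$. $\operatorname{trop}(f)$ is the vertex set of the Newton polyhedron of $\operatorname{Supp}(f)$, $\operatorname{trop}(f/g)=\operatorname{trop}(f)/\operatorname{trop}(g)$, $K(\!(\mathbf{t})\!)^\circ=\{q:\operatorname{trop}(q)\le1\}$. For $a\le b$ in $V\mathbb{B}[\mathbf{t}]$, $a\ll b$ means $a\cap b=\emptyset$; for $\frac ab\le\frac cd$ in $V\mathbb{B}(\mathbf{t})$, $\frac ab\ll\frac cd$ means $a\odot d\ll c\odot b$. *)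

theory Defs
  imports "HOL-Analysis.Analysis"
begin

text \<open>Exponent vectors in N^m are functions 'n \<Rightarrow> nat for a finite index type 'n
  (m = CARD('n)). Multivariate formal power series K[[t]] are coefficient functions
  ('n \<Rightarrow> nat) \<Rightarrow> 'a.\<close>

type_synonym 'n expo = "'n \<Rightarrow> nat"
type_synonym ('n, 'a) mps = "'n expo \<Rightarrow> 'a"

definition expo_add :: "'n expo \<Rightarrow> 'n expo \<Rightarrow> 'n expo" where
  "expo_add a b = (\<lambda>i. a i + b i)"

definition expo_zero :: "'n expo" where
  "expo_zero = (\<lambda>_. 0)"

text \<open>Embedding of N^m into R^m.\<close>
definition emb :: "('n::finite) expo \<Rightarrow> real^'n" where
  "emb e = (\<chi> i. real (e i))"

text \<open>Newton polyhedron conv(A) + R^m_{\<ge>0}.\<close>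
definition newton :: "('n::finite) expo set \<Rightarrow> (real^'n) set" where
  "newton A = {x + y | x y. x \<in> convex hull (emb ` A) \<and> (\<forall>i. 0 \<le> y $ i)}"

text \<open>Vertex set (as a subset of N^m) of the Newton polyhedron of A.\<close>
definition vert :: "('n::finite) expo set \<Rightarrow> 'n expo set" where
  "vert A = {e \<in> A. emb e extreme_point_of newton A}"

text \<open>Operations and order of V B[t].\<close>
definition vb_plus :: "('n::finite) expo set \<Rightarrow> 'n expo set \<Rightarrow> 'n expo set" where
  "vb_plus a b = vert (a \<union> b)"

definition vb_times :: "('n::finite) expo set \<Rightarrow> 'n expo set \<Rightarrow> 'n expo set" where
  "vb_times a b = vert {expo_add x y | x y. x \<in> a \<and> y \<in> b}"

definition vb_one :: "'n expo set" where
  "vb_one = {expo_zero}"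

definition vb_le :: "('n::finite) expo set \<Rightarrow> 'n expo set \<Rightarrow> bool" where
  "vb_le a b \<longleftrightarrow> vb_plus a b = b"

text \<open>a \<ll> b for a \<le> b in V B[t].\<close>
definition vb_ll :: "('n::finite) expo set \<Rightarrow> 'n expo set \<Rightarrow> bool" where
  "vb_ll a b \<longleftrightarrow> vb_le a b \<and> a \<inter> b = {}"

text \<open>Fractions a/b of V B(t), represented as pairs (a, b).\<close>
definition vbf_le :: "('n::finite) expo set \<times> 'n expo set \<Rightarrow> 'n expo set \<times> 'n expo set \<Rightarrow> bool" where
  "vbf_le p q = (case p of (a, b) \<Rightarrow> case q of (c, d) \<Rightarrow> vb_le (vb_times a d) (vb_times b c))"

definition vbf_ll :: "('n::finite) expo set \<times> 'n expo set \<Rightarrow> 'n expo set \<times> 'n expo set \<Rightarrow> bool" where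
  "vbf_ll p q = (case p of (a, b) \<Rightarrow> case q of (c, d) \<Rightarrow>
      vbf_le (a, b) (c, d) \<and> vb_ll (vb_times a d) (vb_times c b))"

definition vbf_one :: "'n expo set \<times> 'n expo set" where
  "vbf_one = (vb_one, vb_one)"

text \<open>Power series arithmetic.\<close>
definition mps_supp :: "('n, 'a::zero) mps \<Rightarrow> 'n expo set" where
  "mps_supp f = {e. f e \<noteq> 0}"

definition mps_mult :: "('n::finite, 'a::comm_ring_1) mps \<Rightarrow> ('n, 'a) mps \<Rightarrow> ('n, 'a) mps" where
  "mps_mult f g = (\<lambda>c. \<Sum>(a, b) \<in> {(a, b). expo_add a b = c}. f a * g b)"

definition mps_one :: "('n, 'a::comm_ring_1) mps" where
  "mps_one = (\<lambda>e. if e = expo_zero then 1 else 0)"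

definition mps_const :: "'a::comm_ring_1 \<Rightarrow> ('n, 'a) mps" where
  "mps_const c = (\<lambda>e. if e = expo_zero then c else 0)"

definition mps_diff :: "('n, 'a::comm_ring_1) mps \<Rightarrow> ('n, 'a) mps \<Rightarrow> ('n, 'a) mps" where
  "mps_diff f g = (\<lambda>e. f e - g e)"

text \<open>Product of F 0, ..., F (n-1).\<close>
primrec mps_prod :: "(nat \<Rightarrow> ('n::finite, 'a::comm_ring_1) mps) \<Rightarrow> nat \<Rightarrow> ('n, 'a) mps" where
  "mps_prod F 0 = mps_one"
| "mps_prod F (Suc n) = mps_mult (mps_prod F n) (F n)"

definition mps_pow :: "('n::finite, 'a::comm_ring_1) mps \<Rightarrow> nat \<Rightarrow> ('n, 'a) mps" where
  "mps_pow f n = mps_prod (\<lambda>_. f) n"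

text \<open>trop of a power series: vertex set of the Newton polyhedron of its support.\<close>
definition trop :: "('n::finite, 'a::comm_ring_1) mps \<Rightarrow> 'n expo set" where
  "trop f = vert (mps_supp f)"

text \<open>trop of the fraction f/g \<in> K((t)), as the pair trop f / trop g.\<close>
definition trop_frac :: "('n::finite, 'a::comm_ring_1) mps \<Rightarrow> ('n, 'a) mps \<Rightarrow> 'n expo set \<times> 'n expo set" where
  "trop_frac f g = (trop f, trop g)"

end

theory Submission
  imports Defs
begin

text \<open>Let P be the Newton polyhedron of g; the hypothesis says that the Newton polyhedron of f
  lies in P. By Dickson's lemma P has finitely many vertices v_1, ..., v_n, and with
  \<alpha>_k = f(v_k) / g(v_k) each factor f - \<alpha>_k g still has its Newton polyhedron
  in P and vanishes at v_k. Newton polyhedra turn products into Minkowski sums, so the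
  product of the n factors has its Newton polyhedron inside n P, the Newton polyhedron of g^n.
  Every vertex of n P is some n v_k, and there the coefficient of the product is the product
  of the coefficients of the factors at v_k, which vanishes. So the product and g^n have
  no vertex in common.\<close>

section \<open>Newton polyhedra\<close>

lemma emb_add: "emb (expo_add a b) = emb a + emb b"
  by (simp add: emb_def expo_add_def vec_eq_iff)

lemma emb_eq_iff [simp]: "emb a = emb b \<longleftrightarrow> a = b"
  by (auto simp: emb_def vec_eq_iff fun_eq_iff)

lemma emb_scale: "emb (\<lambda>i. n * v i) = real n *\<^sub>R emb v"
  by (simp add: emb_def vec_eq_iff)

definition nonneg_orthant :: "(real^'n) set" where
  "nonneg_orthant = {y. \<forall>i. 0 \<le> y $ i}"

lemma convex_nonneg_orthant: "convex nonneg_orthant"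
  unfolding convex_def nonneg_orthant_def by auto

lemma closed_nonneg_orthant: "closed nonneg_orthant"
  unfolding nonneg_orthant_def
  by (intro closed_Collect_all closed_Collect_le) (auto intro: continuous_intros)

lemma nonneg_orthant_plus_nonneg_orthant: "nonneg_orthant + nonneg_orthant = nonneg_orthant"
proof
  show "nonneg_orthant + nonneg_orthant \<subseteq> nonneg_orthant"
    by (auto simp: nonneg_orthant_def set_plus_def)
  show "nonneg_orthant \<subseteq> nonneg_orthant + nonneg_orthant"
    by (auto simp: nonneg_orthant_def set_plus_def intro!: bexI[of _ 0])
qed

lemma emb_in_nonneg_orthant: "emb a \<in> nonneg_orthant"
  by (simp add: emb_def nonneg_orthant_def)

lemma diff_emb_in_nonneg_orthant: "a \<le> b \<Longrightarrow> emb b - emb a \<in> nonneg_orthant"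
  by (simp add: emb_def nonneg_orthant_def le_fun_def)

lemma inner_pos_nonneg_orthant:
  assumes "\<forall>i. 0 < w $ i" "y \<in> nonneg_orthant" "y \<noteq> 0"
  shows "0 < w \<bullet> y"
proof -
  obtain j where "y $ j \<noteq> 0" using assms(3) by (auto simp: vec_eq_iff)
  then have "0 < w $ j * y $ j"
    using assms(1,2) by (simp add: nonneg_orthant_def order_le_neq_trans)
  moreover have "\<forall>i\<in>UNIV. 0 \<le> w $ i * y $ i"
    using assms(1,2) by (simp add: nonneg_orthant_def less_imp_le)
  ultimately show ?thesis
    unfolding inner_vec_def by (intro sum_pos2[of UNIV j]) auto
qed

lemma newton_eq: "newton A = convex hull (emb ` A) + nonneg_orthant"
  by (auto simp: newton_def nonneg_orthant_def set_plus_def)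

lemma convex_newton: "convex (newton A)"
  by (simp add: newton_eq convex_set_plus convex_nonneg_orthant)

lemma closed_newton:
  assumes "finite A"
  shows "closed (newton A)"
proof -
  have sum_eq: "convex hull (emb ` A) + nonneg_orthant =
      (\<Union>x\<in>convex hull (emb ` A). \<Union>y\<in>nonneg_orthant. {x + y})"
    by (auto simp: set_plus_def)
  have "compact (convex hull (emb ` A))"
    using assms by (simp add: compact_convex_hull finite_imp_compact)
  from compact_closed_sums[OF this closed_nonneg_orthant] show ?thesis
    unfolding newton_eq sum_eq .
qed

lemma newton_plus_nonneg_orthant: "newton A + nonneg_orthant = newton A"
  by (simp add: newton_eq add.assoc nonneg_orthant_plus_nonneg_orthant)

lemma convex_hull_subset_newton: "convex hull (emb ` A) \<subseteq> newton A"
proof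
  fix x assume "x \<in> convex hull (emb ` A)"
  then have "x + 0 \<in> newton A"
    unfolding newton_eq by (rule set_plus_intro) (simp add: nonneg_orthant_def)
  then show "x \<in> newton A" by simp
qed

lemma emb_in_newton: "a \<in> A \<Longrightarrow> emb a \<in> newton A"
  by (rule subsetD[OF convex_hull_subset_newton hull_inc]) simp

lemma emb_image_subset_newton: "emb ` A \<subseteq> newton A"
  using emb_in_newton by blast

lemma newton_least:
  assumes "convex T" "emb ` A \<subseteq> T" "T + nonneg_orthant \<subseteq> T"
  shows "newton A \<subseteq> T"
proof -
  have "convex hull (emb ` A) \<subseteq> T"
    using assms(2,1) by (rule hull_minimal)
  then have "newton A \<subseteq> T + nonneg_orthant"
    unfolding newton_eq by (rule set_plus_mono2) simp
  with assms(3) show ?thesis by blast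
qed

lemma newton_subset_iff: "newton A \<subseteq> newton B \<longleftrightarrow> emb ` A \<subseteq> newton B"
proof
  assume "newton A \<subseteq> newton B"
  then show "emb ` A \<subseteq> newton B"
    using emb_in_newton by blast
next
  assume "emb ` A \<subseteq> newton B"
  then show "newton A \<subseteq> newton B"
    by (intro newton_least convex_newton) (simp_all add: newton_plus_nonneg_orthant)
qed

lemma newton_mono: "A \<subseteq> B \<Longrightarrow> newton A \<subseteq> newton B"
  unfolding newton_subset_iff using emb_in_newton by blast

lemma newton_subset_nonneg_orthant: "newton A \<subseteq> nonneg_orthant"
proof (rule newton_least[OF convex_nonneg_orthant])
  show "emb ` A \<subseteq> nonneg_orthant"
    using emb_in_nonneg_orthant by blast
qed (simp add: nonneg_orthant_plus_nonneg_orthant)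

lemma newton_empty [simp]: "newton {} = {}"
  by (simp add: newton_eq)

section \<open>Vertices\<close>

lemma extreme_point_of_upward_closed_minimal:
  assumes ext: "x extreme_point_of S" and up: "S + nonneg_orthant \<subseteq> S"
    and "z \<in> S" "x - z \<in> nonneg_orthant"
  shows "z = x"
proof (rule ccontr)
  assume "z \<noteq> x"
  define y where "y = x - z"
  have "2 *\<^sub>R y \<in> nonneg_orthant"
    using assms(4) by (simp add: y_def nonneg_orthant_def)
  then have "z + 2 *\<^sub>R y \<in> S"
    using up \<open>z \<in> S\<close> by (blast intro: set_plus_intro)
  moreover have "x = midpoint z (z + 2 *\<^sub>R y)"
    by (simp add: y_def midpoint_def vec_eq_iff algebra_simps)
  moreover have "z \<noteq> z + 2 *\<^sub>R y"
    using \<open>z \<noteq> x\<close> by (simp add: y_def)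
  ultimately show False
    using ext \<open>z \<in> S\<close> midpoint_in_open_segment unfolding extreme_point_of_def by metis
qed

lemma extreme_point_of_newton_in_emb:
  assumes "x extreme_point_of newton A"
  shows "x \<in> emb ` A"
proof -
  from assms obtain c y where c: "c \<in> convex hull (emb ` A)" and y: "y \<in> nonneg_orthant"
    and "x = c + y"
    unfolding extreme_point_of_def newton_eq by (auto elim: set_plus_elim)
  moreover have "c \<in> newton A"
    using c convex_hull_subset_newton by blast
  ultimately have "c = x"
    using extreme_point_of_upward_closed_minimal[OF assms _ \<open>c \<in> newton A\<close>]
    by (simp add: newton_plus_nonneg_orthant)
  then have "x extreme_point_of convex hull (emb ` A)"
    using assms c convex_hull_subset_newton unfolding extreme_point_of_def by blast
  then show ?thesis
    by (rule extreme_point_of_convex_hull)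
qed

lemma vert_eq_extreme_points: "vert A = {e. emb e extreme_point_of newton A}"
  by (auto simp: vert_def dest: extreme_point_of_newton_in_emb)

lemma vert_subset: "vert A \<subseteq> A"
  by (auto simp: vert_def)

lemma vert_minimal:
  assumes "e \<in> vert A" "a \<in> A" "a \<le> e"
  shows "a = e"
  using extreme_point_of_upward_closed_minimal[of "emb e" "newton A" "emb a"] assms
  by (simp add: vert_def emb_in_newton newton_plus_nonneg_orthant diff_emb_in_nonneg_orthant)

lemma normal_nonneg_of_upward_closed:
  assumes "y0 \<in> S" "S + nonneg_orthant \<subseteq> S" "\<forall>y\<in>S. b < a \<bullet> y"
  shows "0 \<le> a $ i"
proof (rule ccontr)
  assume neg: "\<not> 0 \<le> a $ i"
  define t where "t = (a \<bullet> y0 - b) / - a $ i"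
  have "0 \<le> t"
    unfolding t_def using assms(1,3) neg by (intro divide_nonneg_pos) auto
  then have "axis i t \<in> nonneg_orthant"
    by (simp add: nonneg_orthant_def axis_def)
  then have "y0 + axis i t \<in> S"
    using assms(1,2) by (blast intro: set_plus_intro)
  then have "b < a \<bullet> (y0 + axis i t)"
    using assms(3) by blast
  also have "a \<bullet> (y0 + axis i t) = a \<bullet> y0 + a $ i * t"
    by (simp add: inner_add_right inner_axis inner_real_def)
  also have "a \<bullet> y0 + a $ i * t = b"
    using neg by (simp add: t_def)
  finally show False by simp
qed

lemma newton_separating_weight:
  assumes "finite A" "x \<notin> newton A"
  shows "\<exists>w. (\<forall>i. 0 < w $ i) \<and> (\<forall>y\<in>newton A. w \<bullet> x < w \<bullet> y)"
proof (cases "A = {}")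
  case True
  then show ?thesis
    by (intro exI[of _ "\<chi> i. 1"]) simp
next
  case False
  then obtain y0 where y0: "y0 \<in> newton A"
    using emb_in_newton by blast
  obtain a b where ab: "a \<bullet> x < b" "\<forall>y\<in>newton A. b < a \<bullet> y"
    using separating_hyperplane_closed_point[OF convex_newton closed_newton[OF assms(1)] assms(2)]
    by blast
  have a_nonneg: "0 \<le> a $ i" for i
    by (rule normal_nonneg_of_upward_closed[OF y0 _ ab(2)]) (simp add: newton_plus_nonneg_orthant)
  \<comment> \<open>Tilting the separating normal towards (1, ..., 1) makes it strictly positive.\<close>
  define s where "s = \<bar>(\<chi> i. 1) \<bullet> x\<bar>"
  define \<epsilon> where "\<epsilon> = (b - a \<bullet> x) / (1 + s)"
  define w where "w = a + \<epsilon> *\<^sub>R (\<chi> i. 1)"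
  have "0 \<le> s"
    by (simp add: s_def)
  then have "0 < \<epsilon>"
    using ab(1) by (simp add: \<epsilon>_def)
  have "w \<bullet> x < b"
  proof -
    have "\<epsilon> * ((\<chi> i. 1) \<bullet> x) \<le> \<epsilon> * s"
      using \<open>0 < \<epsilon>\<close> by (simp add: s_def)
    also have "\<dots> < \<epsilon> * (1 + s)"
      using \<open>0 < \<epsilon>\<close> by simp
    also have "\<dots> = b - a \<bullet> x"
      using \<open>0 \<le> s\<close> by (simp add: \<epsilon>_def)
    finally show ?thesis
      by (simp add: w_def inner_add_left)
  qed
  moreover have "b < w \<bullet> y" if "y \<in> newton A" for y
  proof -
    have "y \<in> nonneg_orthant"
      using newton_subset_nonneg_orthant that by blast
    then have "0 \<le> (\<chi> i. 1) \<bullet> y"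
      by (simp add: inner_vec_def nonneg_orthant_def sum_nonneg)
    then have "a \<bullet> y \<le> w \<bullet> y"
      using \<open>0 < \<epsilon>\<close> by (simp add: w_def inner_add_left)
    then show ?thesis
      using ab(2) that by fastforce
  qed
  moreover have "\<forall>i. 0 < w $ i"
    using a_nonneg \<open>0 < \<epsilon>\<close> by (simp add: w_def add_nonneg_pos)
  ultimately show ?thesis
    by force
qed

lemma convex_insert_open_halfspace:
  fixes a w :: "'a::real_inner"
  shows "convex (insert a {y. w \<bullet> a < w \<bullet> y})"
proof (unfold convex_def, intro ballI allI impI)
  fix x y and u v :: real
  assume xy: "x \<in> insert a {y. w \<bullet> a < w \<bullet> y}" "y \<in> insert a {y. w \<bullet> a < w \<bullet> y}"
    and uv: "0 \<le> u" "0 \<le> v" "u + v = 1"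
  show "u *\<^sub>R x + v *\<^sub>R y \<in> insert a {y. w \<bullet> a < w \<bullet> y}"
  proof (cases "x = a \<and> y = a \<or> u = 0 \<or> v = 0")
    case True
    with xy uv show ?thesis by (auto simp flip: scaleR_left_distrib)
  next
    case False
    have le: "w \<bullet> a \<le> w \<bullet> x" "w \<bullet> a \<le> w \<bullet> y"
      using xy by auto
    have "w \<bullet> a < w \<bullet> x \<and> 0 < u \<or> w \<bullet> a < w \<bullet> y \<and> 0 < v"
      using False xy uv by auto
    then have "u * (w \<bullet> a) + v * (w \<bullet> a) < u * (w \<bullet> x) + v * (w \<bullet> y)"
      using le uv by (auto intro: add_less_le_mono add_le_less_mono mult_strict_left_mono mult_left_mono)
    moreover have "u * (w \<bullet> a) + v * (w \<bullet> a) = w \<bullet> a"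
      using uv(3) by (metis distrib_right mult_1)
    ultimately show ?thesis by (simp add: inner_add_right)
  qed
qed

lemma extreme_point_of_newton_if_notin_newton_Diff:
  assumes "finite M" "p \<in> M" "emb p \<notin> newton (M - {p})"
  shows "emb p extreme_point_of newton M"
proof -
  obtain w where w_pos: "\<forall>i. 0 < w $ i" and sep: "\<forall>y\<in>newton (M - {p}). w \<bullet> emb p < w \<bullet> y"
    using newton_separating_weight assms(1,3) by blast
  \<comment> \<open>T is convex and upward closed, so it contains newton M, and on T the positive
    functional w attains its minimum only at emb p.\<close>
  define T where "T = insert (emb p) {y. w \<bullet> emb p < w \<bullet> y}"
  have "emb q \<in> T" if "q \<in> M" for q
  proof (cases "q = p")
    case False
    then have "emb q \<in> newton (M - {p})"
      using that by (simp add: emb_in_newton)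
    then show ?thesis
      using sep by (simp add: T_def)
  qed (simp add: T_def)
  then have "emb ` M \<subseteq> T"
    by blast
  moreover have "T + nonneg_orthant \<subseteq> T"
  proof (intro subsetI, elim set_plus_elim)
    fix x y z
    assume z: "z = x + y" and x: "x \<in> T" and y: "y \<in> nonneg_orthant"
    show "z \<in> T"
    proof (cases "y = 0")
      case True
      then show ?thesis using x z by simp
    next
      case False
      then have "0 < w \<bullet> y"
        by (rule inner_pos_nonneg_orthant[OF w_pos y])
      moreover have "w \<bullet> emb p \<le> w \<bullet> x"
        using x by (auto simp: T_def)
      ultimately show ?thesis
        by (simp add: z T_def inner_add_right)
    qed
  qed
  ultimately have "newton M \<subseteq> T"
    by (intro newton_least) (simp_all add: T_def convex_insert_open_halfspace)
  then have key: "w \<bullet> emb p \<le> w \<bullet> y \<and> (w \<bullet> y = w \<bullet> emb p \<longrightarrow> y = emb p)"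
    if "y \<in> newton M" for y
    using that unfolding T_def by auto
  show ?thesis
  proof (rule extreme_point_of_Int_supporting_hyperplane_ge[of _ w "w \<bullet> emb p"])
    show "newton M \<inter> {y. w \<bullet> y = w \<bullet> emb p} = {emb p}"
      using key emb_in_newton[OF assms(2)] by auto
    show "\<And>y. y \<in> newton M \<Longrightarrow> w \<bullet> emb p \<le> w \<bullet> y"
      using key by blast
  qed
qed

lemma newton_vert_finite:
  assumes "finite M"
  shows "newton (vert M) = newton M"
  using assms
proof (induction "card M" arbitrary: M rule: less_induct)
  case less
  show ?case
  proof (cases "M \<subseteq> vert M")
    case True
    then show ?thesis
      using vert_subset by (metis subset_antisym)
  next
    case False
    then obtain p where p: "p \<in> M" "p \<notin> vert M"
      by blast
    then have "emb p \<in> newton (M - {p})"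
      using extreme_point_of_newton_if_notin_newton_Diff[OF less.prems p(1)] by (auto simp: vert_def)
    then have "newton (M - {p}) = newton M"
      by (intro subset_antisym) (auto simp: newton_subset_iff intro: emb_in_newton)
    moreover have "card (M - {p}) < card M"
      using less.prems p(1) by (rule card_Diff1_less)
    then have "newton (vert (M - {p})) = newton (M - {p})"
      using less by simp
    ultimately show ?thesis
      by (simp add: vert_eq_extreme_points)
  qed
qed

section \<open>Dickson's lemma and vertex sets of infinite supports\<close>

definition minimal_elements :: "'n expo set \<Rightarrow> 'n expo set" where
  "minimal_elements A = {a \<in> A. \<forall>b\<in>A. b \<le> a \<longrightarrow> b = a}"

lemma nat_seq_has_mono_subseq:
  fixes t :: "nat \<Rightarrow> nat"
  shows "\<exists>r :: nat \<Rightarrow> nat. strict_mono r \<and> mono (\<lambda>n. t (r n))"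
proof -
  obtain f where f: "strict_mono f" "monoseq (\<lambda>n. t (f n))"
    using seq_monosub by blast
  show ?thesis
  proof (cases "mono (\<lambda>n. t (f n))")
    case True
    with f(1) show ?thesis by blast
  next
    case False
    with f(2) have dec: "decseq (\<lambda>n. t (f n))"
      by (simp add: monoseq_iff)
    obtain N where N: "\<forall>n. t (f N) \<le> t (f n)"
      using ex_has_least_nat[of "\<lambda>_. True" 0 "\<lambda>n. t (f n)"] by auto
    have "t (f (n + N)) = t (f N)" for n
      using N decseqD[OF dec, of N "n + N"] by (simp add: antisym)
    moreover have "strict_mono (\<lambda>n. f (n + N))"
      using f(1) by (simp add: strict_mono_def)
    ultimately show ?thesis
      by (intro exI[of _ "\<lambda>n. f (n + N)"]) (simp add: mono_def)
  qed
qed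

lemma nat_vector_seq_has_mono_subseq:
  fixes s :: "nat \<Rightarrow> 'n \<Rightarrow> nat"
  assumes "finite I"
  shows "\<exists>r :: nat \<Rightarrow> nat. strict_mono r \<and> (\<forall>k\<in>I. mono (\<lambda>n. s (r n) k))"
  using assms
proof (induction I rule: finite_induct)
  case empty
  show ?case
    using strict_mono_id by blast
next
  case (insert k I)
  then obtain r1 :: "nat \<Rightarrow> nat" where r1: "strict_mono r1" "\<forall>k\<in>I. mono (\<lambda>n. s (r1 n) k)"
    by blast
  obtain r2 :: "nat \<Rightarrow> nat" where r2: "strict_mono r2" "mono (\<lambda>n. s (r1 (r2 n)) k)"
    using nat_seq_has_mono_subseq[of "\<lambda>n. s (r1 n) k"] by blast
  have "mono (\<lambda>n. s (r1 (r2 n)) k')" if "k' \<in> I" for k'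
    using r1(2) that strict_mono_mono[OF r2(1)] by (simp add: mono_def)
  moreover have "strict_mono (\<lambda>n. r1 (r2 n))"
    using strict_mono_o[OF r1(1) r2(1)] by (simp add: comp_def)
  ultimately show ?case
    using r2(2) by (intro exI[of _ "\<lambda>n. r1 (r2 n)"]) simp
qed

lemma dickson:
  fixes s :: "nat \<Rightarrow> 'n::finite \<Rightarrow> nat"
  obtains i j where "i < j" "s i \<le> s j"
proof -
  obtain r :: "nat \<Rightarrow> nat" where r: "strict_mono r" "\<forall>k. mono (\<lambda>n. s (r n) k)"
    using nat_vector_seq_has_mono_subseq[of UNIV s] by auto
  have "s (r 0) k \<le> s (r 1) k" for k
    using monoD[OF r(2)[rule_format, of k], of 0 1] by simp
  then have "s (r 0) \<le> s (r 1)"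
    by (simp add: le_fun_def)
  moreover have "r 0 < r 1"
    using r(1) by (simp add: strict_mono_def)
  ultimately show ?thesis
    using that by blast
qed

lemma finite_minimal_elements: "finite (minimal_elements (A :: ('n::finite) expo set))"
proof (rule ccontr)
  assume "infinite (minimal_elements A)"
  then obtain s :: "nat \<Rightarrow> 'n \<Rightarrow> nat" where s: "inj s" "range s \<subseteq> minimal_elements A"
    using infinite_iff_countable_subset by metis
  obtain i j where ij: "i < j" "s i \<le> s j"
    using dickson by blast
  have "s j \<in> minimal_elements A" "s i \<in> A"
    using s(2) by (auto simp: minimal_elements_def)
  with ij(2) have "s i = s j"
    by (auto simp: minimal_elements_def)
  with s(1) ij(1) show False
    by (auto dest: injD)
qed

lemma exists_minimal_element_below:
  fixes A :: "('n::finite) expo set"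
  assumes "a \<in> A"
  obtains m where "m \<in> minimal_elements A" "m \<le> a"
proof -
  obtain x where x: "x \<in> A" "x \<le> a" "\<And>y. y \<in> A \<Longrightarrow> y \<le> a \<Longrightarrow> sum x UNIV \<le> sum y UNIV"
    using ex_has_least_nat[of "\<lambda>b. b \<in> A \<and> b \<le> a" a "\<lambda>b. sum b UNIV"] assms by auto
  have "b = x" if b: "b \<in> A" "b \<le> x" for b
  proof -
    have "sum x UNIV \<le> sum b UNIV"
      using x(2,3) b order_trans by blast
    moreover have "sum b UNIV \<le> sum x UNIV"
      using b(2) by (intro sum_mono) (simp add: le_fun_def)
    ultimately have "b i = x i" for i
      using sum_mono_inv[of b UNIV x i] b(2) by (simp add: le_fun_def)
    then show "b = x"
      by (simp add: fun_eq_iff)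
  qed
  with x(1,2) that show ?thesis
    by (auto simp: minimal_elements_def)
qed

lemma newton_minimal_elements: "newton (minimal_elements A) = newton (A :: ('n::finite) expo set)"
proof (rule subset_antisym)
  show "newton (minimal_elements A) \<subseteq> newton A"
    by (rule newton_mono) (auto simp: minimal_elements_def)
  have "emb a \<in> newton (minimal_elements A)" if a: "a \<in> A" for a
  proof -
    obtain m where m: "m \<in> minimal_elements A" "m \<le> a"
      using exists_minimal_element_below[OF a] .
    have "emb m + (emb a - emb m) \<in> newton (minimal_elements A) + nonneg_orthant"
      using emb_in_newton[OF m(1)] diff_emb_in_nonneg_orthant[OF m(2)] by (rule set_plus_intro)
    then show ?thesis
      by (simp add: newton_plus_nonneg_orthant)
  qed
  then show "newton A \<subseteq> newton (minimal_elements A)"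
    unfolding newton_subset_iff by blast
qed

lemma vert_subset_minimal_elements: "vert A \<subseteq> minimal_elements A"
  using vert_minimal vert_subset unfolding minimal_elements_def by blast

lemma finite_vert: "finite (vert (A :: ('n::finite) expo set))"
  using finite_subset[OF vert_subset_minimal_elements finite_minimal_elements] .

lemma newton_vert: "newton (vert A) = newton (A :: ('n::finite) expo set)"
proof -
  have "vert A = vert (minimal_elements A)"
    by (metis vert_eq_extreme_points newton_minimal_elements)
  then show ?thesis
    using newton_vert_finite[OF finite_minimal_elements] by (simp add: newton_minimal_elements)
qed

lemma vert_eq_iff_newton_eq: "vert A = vert B \<longleftrightarrow> newton A = newton (B :: ('n::finite) expo set)"
  by (metis newton_vert vert_eq_extreme_points)

lemma vert_vert: "vert (vert A) = vert (A :: ('n::finite) expo set)"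
  by (simp add: vert_eq_iff_newton_eq newton_vert)

lemma newton_Un_eq_iff: "newton (A \<union> B) = newton B \<longleftrightarrow> newton A \<subseteq> newton B"
proof
  assume "newton (A \<union> B) = newton B"
  then show "newton A \<subseteq> newton B"
    using newton_mono[of A "A \<union> B"] by blast
next
  assume "newton A \<subseteq> newton B"
  then have "emb ` (A \<union> B) \<subseteq> newton B"
    using emb_in_newton by (auto simp: newton_subset_iff)
  then show "newton (A \<union> B) = newton B"
    using newton_mono[of B "A \<union> B"] by (auto simp: newton_subset_iff[symmetric])
qed

lemma vb_le_vert_iff: "vb_le (vert A) (vert B) \<longleftrightarrow> newton A \<subseteq> newton (B :: ('n::finite) expo set)"
proof -
  have "vb_le (vert A) (vert B) \<longleftrightarrow> vert (vert A \<union> vert B) = vert (vert B)"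
    by (simp add: vb_le_def vb_plus_def vert_vert)
  also have "\<dots> \<longleftrightarrow> newton (vert A) \<subseteq> newton (vert B)"
    by (simp add: vert_eq_iff_newton_eq newton_Un_eq_iff)
  finally show ?thesis
    by (simp add: newton_vert)
qed

lemma vb_times_vb_one: "vb_times A vb_one = vert A" "vb_times vb_one A = vert A"
proof -
  have "{expo_add x y | x y. x \<in> A \<and> y \<in> vb_one} = A" "{expo_add x y | x y. x \<in> vb_one \<and> y \<in> A} = A"
    by (auto simp: vb_one_def expo_add_def expo_zero_def)
  then show "vb_times A vb_one = vert A" "vb_times vb_one A = vert A"
    by (simp_all add: vb_times_def)
qed

lemma vbf_le_trop_frac_one:
  "vbf_le (trop_frac f g) vbf_one \<longleftrightarrow> newton (mps_supp f) \<subseteq> newton (mps_supp g)"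
  by (simp add: vbf_le_def trop_frac_def vbf_one_def trop_def vb_times_vb_one vert_vert
      vb_le_vert_iff newton_vert)

lemma vbf_ll_trop_frac_one:
  "vbf_ll (trop_frac f g) vbf_one \<longleftrightarrow>
     newton (mps_supp f) \<subseteq> newton (mps_supp g) \<and> trop f \<inter> trop g = {}"
  by (simp add: vbf_ll_def vbf_le_def vb_ll_def trop_frac_def vbf_one_def trop_def vb_times_vb_one
      vert_vert vb_le_vert_iff newton_vert)

section \<open>Newton polyhedra of products\<close>

definition expo_sums :: "'n expo set \<Rightarrow> 'n expo set \<Rightarrow> 'n expo set" where
  "expo_sums A B = {expo_add a b | a b. a \<in> A \<and> b \<in> B}"

lemma emb_expo_sums: "emb ` expo_sums A B = emb ` A + emb ` B"
proof
  show "emb ` expo_sums A B \<subseteq> emb ` A + emb ` B"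
    by (auto simp: expo_sums_def emb_add intro!: set_plus_intro)
  show "emb ` A + emb ` B \<subseteq> emb ` expo_sums A B"
  proof (intro subsetI, elim set_plus_elim)
    fix x u v
    assume "x = u + v" "u \<in> emb ` A" "v \<in> emb ` B"
    then obtain a b where "a \<in> A" "b \<in> B" "x = emb (expo_add a b)"
      by (auto simp: emb_add)
    then show "x \<in> emb ` expo_sums A B"
      by (auto simp: expo_sums_def)
  qed
qed

lemma newton_expo_sums: "newton (expo_sums A B) = newton A + newton B"
proof -
  have "newton (expo_sums A B) =
      (convex hull (emb ` A) + convex hull (emb ` B)) + (nonneg_orthant + nonneg_orthant)"
    by (simp add: newton_eq emb_expo_sums convex_hull_set_plus nonneg_orthant_plus_nonneg_orthant)
  also have "\<dots> = newton A + newton B"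
    by (simp add: newton_eq ac_simps)
  finally show ?thesis .
qed

lemma finite_expo_add_eq: "finite {(a, b). expo_add a b = (c :: 'n::finite expo)}"
proof (rule finite_subset)
  have "{a :: 'n expo. a \<le> c} = Pi\<^sub>E UNIV (\<lambda>i. {..c i})"
    by (auto simp: PiE_UNIV_domain Pi_def le_fun_def)
  then have "finite {a :: 'n expo. a \<le> c}"
    by (simp add: finite_PiE)
  then show "finite ({a. a \<le> c} \<times> {b. b \<le> c})"
    by blast
  show "{(a, b). expo_add a b = c} \<subseteq> {a. a \<le> c} \<times> {b. b \<le> c}"
    by (auto simp: expo_add_def le_fun_def)
qed

lemma mps_mult_eq_single_term:
  fixes F G :: "('n::finite, 'a::comm_ring_1) mps"
  assumes "expo_add a b = c"
    and "\<And>x y. expo_add x y = c \<Longrightarrow> (x, y) \<noteq> (a, b) \<Longrightarrow> F x * G y = 0"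
  shows "mps_mult F G c = F a * G b"
proof -
  have "mps_mult F G c = (\<Sum>(x, y) \<in> {(a, b)}. F x * G y)"
    unfolding mps_mult_def using assms
    by (intro sum.mono_neutral_right finite_expo_add_eq) auto
  then show ?thesis
    by simp
qed

lemma expo_add_zero_left: "expo_add expo_zero b = b"
  by (simp add: expo_add_def expo_zero_def)

lemma mps_mult_const: "mps_mult (mps_const \<alpha>) g e = \<alpha> * (g :: ('n::finite, 'a::comm_ring_1) mps) e"
proof -
  have "mps_mult (mps_const \<alpha>) g e = (mps_const \<alpha> :: ('n, 'a) mps) expo_zero * g e"
    by (rule mps_mult_eq_single_term[where a = expo_zero and b = e])
      (auto simp: mps_const_def expo_add_zero_left)
  then show ?thesis
    by (simp add: mps_const_def)
qed

lemma mps_mult_one_left: "mps_mult mps_one (g :: ('n::finite, 'a::comm_ring_1) mps) = g"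
proof -
  have one: "mps_one = (mps_const 1 :: ('n, 'a) mps)"
    by (simp add: mps_one_def mps_const_def)
  show ?thesis
    unfolding one by (simp add: fun_eq_iff mps_mult_const)
qed

lemma mps_supp_mult_subset:
  "mps_supp (mps_mult f g) \<subseteq> expo_sums (mps_supp f) (mps_supp (g :: ('n::finite, 'a::comm_ring_1) mps))"
proof
  fix c
  assume "c \<in> mps_supp (mps_mult f g)"
  then have "(\<Sum>(a, b) \<in> {(a, b). expo_add a b = c}. f a * g b) \<noteq> 0"
    by (simp add: mps_supp_def mps_mult_def)
  then obtain p where "p \<in> {(a, b). expo_add a b = c}" "(case p of (a, b) \<Rightarrow> f a * g b) \<noteq> 0"
    by (rule sum.not_neutral_contains_not_neutral)
  then obtain a b where "expo_add a b = c" "f a \<noteq> 0" "g b \<noteq> 0"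
    by (cases p) (auto dest: mult_not_zero)
  then show "c \<in> expo_sums (mps_supp f) (mps_supp g)"
    unfolding expo_sums_def mps_supp_def by blast
qed

lemma extreme_point_of_sum_unique:
  fixes x x' y y' :: "'a::real_vector"
  assumes "x + y extreme_point_of (X + Y)" "x \<in> X" "x' \<in> X" "y \<in> Y" "y' \<in> Y"
    and "x + y = x' + y'"
  shows "x = x'"
proof -
  have "x + y' \<in> X + Y" "x' + y \<in> X + Y"
    using assms(2-5) by (auto intro: set_plus_intro)
  moreover have "x + y' + (x' + y) = (x + y) + (x + y)"
    using assms(6) by (simp add: algebra_simps)
  then have "x + y = midpoint (x + y') (x' + y)"
    by (simp add: midpoint_def scaleR_2[symmetric])
  ultimately have "x + y' = x' + y"
    using assms(1) midpoint_in_open_segment unfolding extreme_point_of_def by metis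
  then have "(x + y') + (x + y) = (x' + y) + (x' + y')"
    using assms(6) by simp
  then have "2 *\<^sub>R x = 2 *\<^sub>R x'"
    by (simp add: scaleR_2 algebra_simps)
  then show "x = x'"
    by simp
qed

lemma mps_mult_at_extreme_point:
  fixes F G :: "('n::finite, 'a::comm_ring_1) mps"
  assumes "emb ` mps_supp F \<subseteq> X" "emb ` mps_supp G \<subseteq> Y" "emb a \<in> X" "emb b \<in> Y"
    and "emb (expo_add a b) extreme_point_of (X + Y)"
  shows "mps_mult F G (expo_add a b) = F a * G b"
proof (rule mps_mult_eq_single_term[OF refl])
  fix a' b'
  assume eq: "expo_add a' b' = expo_add a b" and ne: "(a', b') \<noteq> (a, b)"
  show "F a' * G b' = 0"
  proof (rule ccontr)
    assume "F a' * G b' \<noteq> 0"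
    then have "emb a' \<in> X" "emb b' \<in> Y"
      using assms(1,2) by (auto simp: mps_supp_def image_subset_iff dest: mult_not_zero)
    moreover have "emb a + emb b = emb a' + emb b'"
      using eq by (simp add: emb_add[symmetric])
    ultimately have "a = a'"
      using extreme_point_of_sum_unique[of "emb a" "emb b" X Y "emb a'" "emb b'"] assms(3-5)
      by (simp add: emb_add)
    moreover have "b = b'"
      using eq calculation by (metis emb_add add_left_cancel emb_eq_iff)
    ultimately show False
      using ne by simp
  qed
qed

lemma newton_mps_mult_subset:
  "newton (mps_supp (mps_mult f g)) \<subseteq>
     newton (mps_supp f) + newton (mps_supp (g :: ('n::finite, 'a::comm_ring_1) mps))"
  using newton_mono[OF mps_supp_mult_subset] by (simp add: newton_expo_sums)

lemma newton_mps_mult: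
  fixes f g :: "('n::finite, 'a::idom) mps"
  shows "newton (mps_supp (mps_mult f g)) = newton (mps_supp f) + newton (mps_supp g)"
proof (rule subset_antisym[OF newton_mps_mult_subset])
  let ?S = "expo_sums (mps_supp f) (mps_supp g)"
  have "e \<in> mps_supp (mps_mult f g)" if e: "e \<in> vert ?S" for e
  proof -
    obtain a b where ab: "e = expo_add a b" "f a \<noteq> 0" "g b \<noteq> 0"
      using vert_subset e by (force simp: expo_sums_def mps_supp_def)
    have "emb e extreme_point_of newton (mps_supp f) + newton (mps_supp g)"
      using e by (simp add: vert_def newton_expo_sums)
    then have "mps_mult f g e = f a * g b"
      unfolding ab(1)
      by (intro mps_mult_at_extreme_point) (auto simp: ab mps_supp_def intro: emb_in_newton)
    with ab show ?thesis
      by (simp add: mps_supp_def)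
  qed
  then have "newton (vert ?S) \<subseteq> newton (mps_supp (mps_mult f g))"
    by (intro newton_mono) blast
  then show "newton (mps_supp f) + newton (mps_supp g) \<subseteq> newton (mps_supp (mps_mult f g))"
    by (simp add: newton_vert newton_expo_sums)
qed

lemma scaleR_image_add_convex:
  fixes S :: "'a::real_vector set"
  assumes "convex S" "0 \<le> a" "0 \<le> b"
  shows "(*\<^sub>R) (a + b) ` S = (*\<^sub>R) a ` S + (*\<^sub>R) b ` S"
proof
  show "(*\<^sub>R) (a + b) ` S \<subseteq> (*\<^sub>R) a ` S + (*\<^sub>R) b ` S"
    by (auto simp: scaleR_left_distrib intro!: set_plus_intro)
  show "(*\<^sub>R) a ` S + (*\<^sub>R) b ` S \<subseteq> (*\<^sub>R) (a + b) ` S"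
  proof (intro subsetI, elim set_plus_elim)
    fix z u v
    assume "z = u + v" "u \<in> (*\<^sub>R) a ` S" "v \<in> (*\<^sub>R) b ` S"
    then obtain x y where xy: "x \<in> S" "y \<in> S" "z = a *\<^sub>R x + b *\<^sub>R y"
      by blast
    show "z \<in> (*\<^sub>R) (a + b) ` S"
    proof (cases "a + b = 0")
      case True
      then have "a = 0" "b = 0"
        using assms(2,3) by linarith+
      then have "z = (a + b) *\<^sub>R x"
        using xy(3) by simp
      then show ?thesis
        using xy(1) by blast
    next
      case False
      define w where "w = (a / (a + b)) *\<^sub>R x + (b / (a + b)) *\<^sub>R y"
      have "w \<in> S"
        unfolding w_def using convexD[OF assms(1) xy(1,2)] assms(2,3) False
        by (simp add: add_divide_distrib[symmetric])
      moreover have "z = (a + b) *\<^sub>R w"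
        using False xy(3) by (simp add: w_def scaleR_add_right)
      ultimately show ?thesis
        by blast
    qed
  qed
qed

lemma scaleR_image_Suc_convex:
  fixes S :: "'a::real_vector set"
  assumes "convex S"
  shows "(*\<^sub>R) (real (Suc n)) ` S = (*\<^sub>R) (real n) ` S + S"
proof -
  have "(*\<^sub>R) (real n + 1) ` S = (*\<^sub>R) (real n) ` S + (*\<^sub>R) 1 ` S"
    by (rule scaleR_image_add_convex[OF assms]) simp_all
  then show ?thesis
    by (simp add: add.commute)
qed

lemma extreme_point_of_scaleR_image:
  fixes S :: "'a::real_vector set"
  assumes "c \<noteq> 0"
  shows "(c *\<^sub>R x) extreme_point_of ((*\<^sub>R) c ` S) \<longleftrightarrow> x extreme_point_of S"
  using face_of_linear_image[of "(*\<^sub>R) c" "{x}" S] assms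
  by (simp add: face_of_singleton linear_scaleR inj_on_def)

lemma mps_prod_one: "mps_prod H 1 = (H 0 :: ('n::finite, 'a::comm_ring_1) mps)"
  unfolding One_nat_def by (simp add: mps_mult_one_left)

lemma newton_mps_prod_subset:
  fixes H :: "nat \<Rightarrow> ('n::finite, 'a::comm_ring_1) mps"
  assumes "convex P" "\<And>k. newton (mps_supp (H k)) \<subseteq> P" "0 < n"
  shows "newton (mps_supp (mps_prod H n)) \<subseteq> (*\<^sub>R) (real n) ` P"
  using assms(3)
proof (induction n rule: nat_induct_non_zero)
  case 1
  show ?case
    using assms(2)[of 0] by (simp add: mps_prod_one mps_mult_one_left)
next
  case (Suc n)
  have "newton (mps_supp (mps_prod H (Suc n))) \<subseteq>
      newton (mps_supp (mps_prod H n)) + newton (mps_supp (H n))"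
    by (simp add: newton_mps_mult_subset)
  also have "\<dots> \<subseteq> (*\<^sub>R) (real n) ` P + P"
    by (rule set_plus_mono2[OF Suc.IH assms(2)])
  also have "\<dots> = (*\<^sub>R) (real (Suc n)) ` P"
    by (rule scaleR_image_Suc_convex[OF assms(1), symmetric])
  finally show ?case .
qed

lemma newton_mps_pow:
  fixes g :: "('n::finite, 'a::idom) mps"
  assumes "0 < n"
  shows "newton (mps_supp (mps_pow g n)) = (*\<^sub>R) (real n) ` newton (mps_supp g)"
  using assms
proof (induction n rule: nat_induct_non_zero)
  case 1
  show ?case
    by (simp add: mps_pow_def mps_prod_one mps_mult_one_left)
next
  case (Suc n)
  have "mps_pow g (Suc n) = mps_mult (mps_pow g n) g"
    by (simp add: mps_pow_def)
  then have "newton (mps_supp (mps_pow g (Suc n))) =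
      (*\<^sub>R) (real n) ` newton (mps_supp g) + newton (mps_supp g)"
    by (simp only: newton_mps_mult Suc.IH)
  also have "\<dots> = (*\<^sub>R) (real (Suc n)) ` newton (mps_supp g)"
    by (rule scaleR_image_Suc_convex[OF convex_newton, symmetric])
  finally show ?case .
qed

lemma mps_prod_at_multiple_of_extreme_point:
  fixes H :: "nat \<Rightarrow> ('n::finite, 'a::comm_ring_1) mps"
  assumes "convex P" "\<And>k. newton (mps_supp (H k)) \<subseteq> P" "emb v extreme_point_of P" "0 < n"
  shows "mps_prod H n (\<lambda>i. n * v i) = (\<Prod>k<n. H k v)"
  using assms(4)
proof (induction n rule: nat_induct_non_zero)
  case 1
  show ?case
    by (simp add: mps_prod_one mps_mult_one_left)
next
  case (Suc n)
  let ?nP = "(*\<^sub>R) (real n) ` P"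
  have split: "(\<lambda>i. Suc n * v i) = expo_add (\<lambda>i. n * v i) v"
    by (simp add: expo_add_def fun_eq_iff)
  have "real (Suc n) \<noteq> 0"
    by simp
  then have "real (Suc n) *\<^sub>R emb v extreme_point_of (*\<^sub>R) (real (Suc n)) ` P"
    using extreme_point_of_scaleR_image assms(3) by blast
  then have ext: "emb (expo_add (\<lambda>i. n * v i) v) extreme_point_of ?nP + P"
    unfolding split[symmetric] emb_scale scaleR_image_Suc_convex[OF assms(1)] .
  have "mps_prod H (Suc n) (\<lambda>i. Suc n * v i) = mps_prod H n (\<lambda>i. n * v i) * H n v"
    unfolding split mps_prod.simps
  proof (rule mps_mult_at_extreme_point[OF _ _ _ _ ext])
    show "emb ` mps_supp (mps_prod H n) \<subseteq> ?nP"
      using emb_image_subset_newton newton_mps_prod_subset[OF assms(1,2) Suc.hyps] by (rule order_trans)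
    show "emb ` mps_supp (H n) \<subseteq> P"
      using emb_image_subset_newton assms(2) by (rule order_trans)
    show "emb (\<lambda>i. n * v i) \<in> ?nP" "emb v \<in> P"
      using assms(3) by (auto simp: emb_scale extreme_point_of_def)
  qed
  also have "\<dots> = (\<Prod>k<Suc n. H k v)"
    by (simp add: Suc.IH)
  finally show ?case .
qed

lemma vert_mps_pow:
  fixes g :: "('n::finite, 'a::idom) mps"
  assumes "0 < n" "e \<in> vert (mps_supp (mps_pow g n))"
  obtains v where "v \<in> vert (mps_supp g)" "e = (\<lambda>i. n * v i)"
proof -
  let ?x = "inverse (real n) *\<^sub>R emb e"
  have "real n \<noteq> 0"
    using assms(1) by simp
  moreover have "real n *\<^sub>R ?x extreme_point_of (*\<^sub>R) (real n) ` newton (mps_supp g)"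
    using assms by (simp add: vert_def newton_mps_pow)
  ultimately have "?x extreme_point_of newton (mps_supp g)"
    using extreme_point_of_scaleR_image by blast
  moreover obtain v where "v \<in> mps_supp g" "emb v = ?x"
    using extreme_point_of_newton_in_emb[OF calculation] by force
  ultimately have "v \<in> vert (mps_supp g)"
    by (simp add: vert_def)
  moreover have "emb e = emb (\<lambda>i. n * v i)"
    using \<open>emb v = ?x\<close> \<open>real n \<noteq> 0\<close> by (simp add: emb_scale)
  ultimately show ?thesis
    using that by simp
qed

section \<open>Factors vanishing at the vertices\<close>

lemma mps_diff_const_mult_apply:
  "mps_diff f (mps_mult (mps_const c) g) e = f e - c * (g :: ('n::finite, 'a::comm_ring_1) mps) e"
  by (simp add: mps_diff_def mps_mult_const)

lemma newton_diff_const_mult_subset: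
  fixes f g :: "('n::finite, 'a::comm_ring_1) mps"
  assumes "newton (mps_supp f) \<subseteq> newton (mps_supp g)"
  shows "newton (mps_supp (mps_diff f (mps_mult (mps_const c) g))) \<subseteq> newton (mps_supp g)"
proof -
  have "mps_supp (mps_diff f (mps_mult (mps_const c) g)) \<subseteq> mps_supp f \<union> mps_supp g"
    by (auto simp: mps_supp_def mps_diff_const_mult_apply)
  from newton_mono[OF this] show ?thesis
    using assms newton_Un_eq_iff by blast
qed

lemma exists_coeffs_vanishing_at_vertices:
  fixes f g :: "('n::finite, 'a::field) mps"
  assumes "g \<noteq> (\<lambda>_. 0)" "newton (mps_supp f) \<subseteq> newton (mps_supp g)"
  obtains n :: nat and \<alpha> :: "nat \<Rightarrow> 'a" where "0 < n"
    and "\<And>v. v \<in> vert (mps_supp g) \<Longrightarrow> \<exists>k<n. mps_diff f (mps_mult (mps_const (\<alpha> k)) g) v = 0"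
proof -
  define V where "V = vert (mps_supp g)"
  have "mps_supp g \<noteq> {}"
    using assms(1) by (auto simp: mps_supp_def)
  then have "V \<noteq> {}"
    using emb_in_newton newton_vert[of "mps_supp g"] by (force simp: V_def)
  then have "0 < card V"
    using finite_vert by (simp add: V_def card_gt_0_iff)
  obtain h where h: "bij_betw h {..<card V} V"
    using ex_bij_betw_nat_finite[OF finite_vert] by (auto simp: V_def atLeast0LessThan)
  show ?thesis
  proof (rule that[of "card V" "\<lambda>k. f (h k) / g (h k)"])
    show "0 < card V"
      by fact
    fix v
    assume v: "v \<in> vert (mps_supp g)"
    then have "v \<in> h ` {..<card V}"
      using h by (simp add: V_def bij_betw_def)
    then obtain k where "k < card V" "h k = v"
      by (metis imageE lessThan_iff)
    moreover have "g v \<noteq> 0"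
      using v vert_subset[of "mps_supp g"] by (auto simp: mps_supp_def)
    ultimately show "\<exists>k<card V. mps_diff f (mps_mult (mps_const (f (h k) / g (h k))) g) v = 0"
      by (auto simp: mps_diff_const_mult_apply)
  qed
qed

lemma vbf_ll_mps_prod_mps_pow:
  fixes g :: "('n::finite, 'a::idom) mps"
  assumes "0 < n" "\<And>k. newton (mps_supp (H k)) \<subseteq> newton (mps_supp g)"
    and "\<And>v. v \<in> vert (mps_supp g) \<Longrightarrow> \<exists>k<n. H k v = 0"
  shows "vbf_ll (trop_frac (mps_prod H n) (mps_pow g n)) vbf_one"
proof -
  have "newton (mps_supp (mps_prod H n)) \<subseteq> newton (mps_supp (mps_pow g n))"
    unfolding newton_mps_pow[OF assms(1)]
    by (rule newton_mps_prod_subset[of _ H, OF convex_newton assms(2,1)])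
  moreover have "trop (mps_prod H n) \<inter> trop (mps_pow g n) = {}"
  proof (rule equals0I)
    fix e
    assume "e \<in> trop (mps_prod H n) \<inter> trop (mps_pow g n)"
    then have "mps_prod H n e \<noteq> 0" and e: "e \<in> vert (mps_supp (mps_pow g n))"
      using vert_subset by (auto simp: trop_def mps_supp_def)
    obtain v where v: "v \<in> vert (mps_supp g)" "e = (\<lambda>i. n * v i)"
      using vert_mps_pow[OF assms(1) e] by blast
    then obtain k where "k < n" "H k v = 0"
      using assms(3) by blast
    then have "(\<Prod>j<n. H j v) = 0"
      by (auto intro: prod_zero)
    moreover have "emb v extreme_point_of newton (mps_supp g)"
      using v(1) by (simp add: vert_def)
    ultimately have "mps_prod H n e = 0"
      using mps_prod_at_multiple_of_extreme_point[of _ H, OF convex_newton assms(2) _ assms(1)] v(2)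
      by simp
    with \<open>mps_prod H n e \<noteq> 0\<close> show False
      by contradiction
  qed
  ultimately show ?thesis
    by (simp add: vbf_ll_trop_frac_one)
qed

theorem lemma4p8:
  fixes f g :: "('n::finite, 'a::field_char_0) mps"
  assumes "g \<noteq> (\<lambda>_. 0)"
    and "vbf_le (trop_frac f g) vbf_one"
  shows "\<exists>n \<ge> 1. \<exists>\<alpha> :: nat \<Rightarrow> 'a.
           vbf_ll (trop_frac (mps_prod (\<lambda>k. mps_diff f (mps_mult (mps_const (\<alpha> k)) g)) n)
                             (mps_pow g n))
                  vbf_one"
proof -
  have f_le_g: "newton (mps_supp f) \<subseteq> newton (mps_supp g)"
    using assms(2) by (simp add: vbf_le_trop_frac_one)
  obtain n :: nat and \<alpha> :: "nat \<Rightarrow> 'a" where "0 < n"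
    and vanish: "\<And>v. v \<in> vert (mps_supp g) \<Longrightarrow> \<exists>k<n. mps_diff f (mps_mult (mps_const (\<alpha> k)) g) v = 0"
    using exists_coeffs_vanishing_at_vertices[OF assms(1) f_le_g] by blast
  have "vbf_ll (trop_frac (mps_prod (\<lambda>k. mps_diff f (mps_mult (mps_const (\<alpha> k)) g)) n)
      (mps_pow g n)) vbf_one"
    using \<open>0 < n\<close> newton_diff_const_mult_subset[OF f_le_g] vanish
    by (rule vbf_ll_mps_prod_mps_pow)
  with \<open>0 < n\<close> show ?thesis
    by (intro exI[of _ n] conjI exI[of _ \<alpha>]) simp_all
qed

end
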